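(* The following hold: (1) $\omega$ is linearizable, i.e. every $\omega$-like countable partial order has a linear extension which is also $\omega$-like; (2) $\omega^*$ is linearizable, i.e. every $\omega^*$-like countable partial order has a linear extension which is also $\omega^*$-like; (3) $\omega+\omega^*$ is linearizable, i.e. every $\omega+\omega^*$-like countable partial order has a linear extension which is also $\omega+\omega^*$-like; (4) $\zeta$ is linearizable, i.e. every $\zeta$-like countable partial order has a linear extension which is also $\zeta$-like.
   Context: Here $\omega$ is the order type of the natural numbers, $\omega^*$ its inverse, and $\zeta$ the order type of the integers. A countable partial order $(P,\leq_P)$ (finite ones allowed) is called: - $\omega$-like if every element of $P$ has finitely many predecessors; - $\omega^*$-like if every element of $P$ has finitely many successors; - $\omega+\omega^*$-like if every element of $P$ has finitely many predecessors or finitely many successors; - $\zeta$-like if for every pair of elements $x,y\in P$ there exist only finitely many elements $z\in P$ with $x<_P z<_P y$. The predecessors of $x$ are the $y$ with $y<_P x$, and the successors of $x$ are the $y$ with $x<_P y$. A linear extension of $(P,\leq_P)$ is a linear order $\leq_L$ on the same set $P$ such that $x\leq_P y$ implies $x\leq_L y$. For $\tau\in\{\omega,\omega^*,\omega+\omega^*,\zeta\}$, $\tau$ is linearizable if every $\tau$-like partial order has a linear extension which is also $\tau$-like. *)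

theory Defs
  imports Main "HOL-Library.Countable_Set"
begin

(* An order is a carrier P together with a reflexive relation r on P, so the strict
   order is r minus the diagonal; the sets underS r x and aboveS r x of the library are
   then the strict predecessors and the strict successors of x. *)

definition countable_partial_order :: "'a set \<Rightarrow> 'a rel \<Rightarrow> bool" where
  "countable_partial_order P r \<longleftrightarrow> countable P \<and> partial_order_on P r"

definition omega_like :: "'a set \<Rightarrow> 'a rel \<Rightarrow> bool" where
  "omega_like P r \<longleftrightarrow> countable_partial_order P r \<and> (\<forall>x\<in>P. finite (underS r x))"

definition omega_star_like :: "'a set \<Rightarrow> 'a rel \<Rightarrow> bool" where
  "omega_star_like P r \<longleftrightarrow> countable_partial_order P r \<and> (\<forall>x\<in>P. finite (aboveS r x))"

definition omega_plus_omega_star_like :: "'a set \<Rightarrow> 'a rel \<Rightarrow> bool" where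
  "omega_plus_omega_star_like P r \<longleftrightarrow>
     countable_partial_order P r \<and> (\<forall>x\<in>P. finite (underS r x) \<or> finite (aboveS r x))"

definition zeta_like :: "'a set \<Rightarrow> 'a rel \<Rightarrow> bool" where
  "zeta_like P r \<longleftrightarrow>
     countable_partial_order P r \<and> (\<forall>x\<in>P. \<forall>y\<in>P. finite (aboveS r x \<inter> underS r y))"

definition linear_extension :: "'a set \<Rightarrow> 'a rel \<Rightarrow> 'a rel \<Rightarrow> bool" where
  "linear_extension P r L \<longleftrightarrow> linear_order_on P L \<and> r \<subseteq> L"

(* The order type enters only through its likeness predicate. The quantifiers range over
   carriers inside the type 'a; universality over all countable partial orders comes from
   'a being a free type variable. *)
definition linearizable :: "('a set \<Rightarrow> 'a rel \<Rightarrow> bool) \<Rightarrow> bool" where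
  "linearizable tau_like \<longleftrightarrow>
     (\<forall>P r. tau_like P r \<longrightarrow> (\<exists>L. linear_extension P r L \<and> tau_like P L))"

end

theory Submission
  imports Defs "HOL-Library.Nat_Bijection" "HOL-Library.Product_Lexorder"
begin

text \<open>
  In all four cases the linear extension is read off from an injective monotone map (a key) into
  a concrete linear order, so only the key has to be found.

  Where every element has a finite down-set, coding that down-set as a natural number, by summing
  \<open>2\<^sup>i\<close> over the indices \<open>i\<close> of its elements in an enumeration of the carrier, is monotone because
  larger elements have larger down-sets, and injective by antisymmetry. This settles \<open>\<omega>\<close>, and
  \<open>\<omega>\<^sup>*\<close> by duality. For \<open>\<omega> + \<omega>\<^sup>*\<close> the elements with finitely many predecessors form a down-set;
  it is put below its complement, with the down-set code as key on the first part and the negated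
  up-set code on the second.

  For \<open>\<zeta>\<close> the carrier is exhausted by an increasing chain of finite convex sets \<open>C n\<close>, the convex
  hulls of the initial segments of an enumeration. A point first appearing in \<open>C n\<close> lies, by
  convexity of the preceding stage, not both above one and below another of the earlier points; so
  the new points can be put above all earlier ones if they exceed one of them, and below all earlier
  ones otherwise. Recording the stage with the corresponding sign gives a monotone map into the
  integers with finite fibres, and down-set codes inside each fibre break the ties. Between two
  given points there are then only finitely many fibres, each of them finite.
\<close>

section \<open>Linear extensions from monotone keys\<close>

definition key_order :: "'a set \<Rightarrow> ('a \<Rightarrow> 'k::linorder) \<Rightarrow> 'a rel" where
  "key_order P key = {(x, y) \<in> P \<times> P. key x \<le> key y}"

lemma linear_extension_key_order:
  assumes "partial_order_on P r" and inj: "inj_on key P"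
    and mono: "\<And>x y. (x, y) \<in> r \<Longrightarrow> key x \<le> key y"
  shows "linear_extension P r (key_order P key)"
proof -
  have "r \<subseteq> P \<times> P"
    using assms(1) by (rule partial_order_onD)
  moreover have "antisym (key_order P key)"
    using inj by (auto simp: antisym_def key_order_def inj_on_def)
  moreover have "trans (key_order P key)"
    unfolding key_order_def by (rule transI) (auto intro: order_trans)
  moreover have "refl_on P (key_order P key)" "total_on P (key_order P key)"
      "key_order P key \<subseteq> P \<times> P"
    by (auto simp: key_order_def refl_on_def total_on_def)
  ultimately show ?thesis
    using mono by (auto simp: linear_extension_def order_on_defs key_order_def)
qed

lemma countable_partial_order_linear_extension:
  assumes "countable_partial_order P r" "linear_extension P r L"
  shows "countable_partial_order P L"
  using assms by (simp add: countable_partial_order_def linear_extension_def linear_order_on_def)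

section \<open>Coding finite down-sets\<close>

definition downset_code :: "'a set \<Rightarrow> 'a rel \<Rightarrow> 'a \<Rightarrow> nat" where
  "downset_code P r x = set_encode (to_nat_on P ` under r x)"

lemma finite_under_iff_underS: "finite (under r x) \<longleftrightarrow> finite (underS r x)"
proof -
  have "underS r x \<subseteq> under r x" "under r x \<subseteq> insert x (underS r x)"
    by (auto simp: under_def underS_def)
  then show ?thesis
    by (meson finite_insert finite_subset)
qed

lemma finite_under_converse_iff_aboveS: "finite (under (r\<inverse>) x) \<longleftrightarrow> finite (aboveS r x)"
  by (simp add: finite_under_iff_underS underS_def aboveS_def)

text \<open>Transitivity makes the down-set of a smaller element a subset, and the code is a sum of
  nonnegative terms over the down-set.\<close>

lemma downset_code_mono:
  assumes "trans r" "(x, y) \<in> r" "finite (under r y)"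
  shows "downset_code P r x \<le> downset_code P r y"
proof -
  have "under r x \<subseteq> under r y"
    using assms(1,2) by (auto simp: under_def dest: transD)
  then show ?thesis
    using assms(3) unfolding downset_code_def set_encode_def
    by (intro sum_mono2) auto
qed

text \<open>An element is the greatest element of its down-set, hence determined by it.\<close>

lemma downset_code_inj:
  assumes po: "countable_partial_order P r" and "x \<in> P" "y \<in> P"
    and fin: "finite (under r x)" "finite (under r y)"
    and eq: "downset_code P r x = downset_code P r y"
  shows "x = y"
proof -
  have r: "refl_on P r" "antisym r" "r \<subseteq> P \<times> P" and "countable P"
    using po by (auto simp: countable_partial_order_def dest: partial_order_onD)
  have sub: "under r x \<subseteq> P" "under r y \<subseteq> P"
    using r(3) by (auto simp: under_def)
  have "to_nat_on P ` under r x = to_nat_on P ` under r y"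
    using eq fin by (simp add: downset_code_def set_encode_eq)
  then have "under r x = under r y"
    using inj_on_image_eq_iff[OF inj_on_to_nat_on[OF \<open>countable P\<close>] sub] by simp
  moreover have "x \<in> under r x" "y \<in> under r y"
    using r(1) \<open>x \<in> P\<close> \<open>y \<in> P\<close> by (auto simp: under_def refl_on_def)
  ultimately show "x = y"
    using r(2) by (auto simp: under_def dest: antisymD)
qed

section \<open>The order types \<open>\<omega>\<close> and \<open>\<omega>\<^sup>*\<close>\<close>

lemma linearizable_omega: "linearizable omega_like"
  unfolding linearizable_def
proof (intro allI impI)
  fix P :: "'a set" and r
  assume omega: "omega_like P r"
  then have cpo: "countable_partial_order P r"
    by (simp add: omega_like_def)
  then have po: "partial_order_on P r" and r: "trans r" "r \<subseteq> P \<times> P"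
    by (auto simp: countable_partial_order_def dest: partial_order_onD)
  have fin: "finite (under r x)" if "x \<in> P" for x
    using omega that by (simp add: omega_like_def finite_under_iff_underS)
  define key where "key = downset_code P r"
  have mono: "key x \<le> key y" if "(x, y) \<in> r" for x y
    using downset_code_mono[OF r(1) that fin] r(2) that by (auto simp: key_def)
  have inj: "inj_on key P"
    using downset_code_inj[OF cpo] fin by (auto intro!: inj_onI simp: key_def)
  let ?L = "key_order P key"
  have ext: "linear_extension P r ?L"
    by (rule linear_extension_key_order[OF po inj mono])
  have "finite (underS ?L x)" for x
  proof (rule inj_on_finite)
    show "inj_on key (underS ?L x)"
      using inj by (rule inj_on_subset) (auto simp: underS_def key_order_def)
    show "key ` underS ?L x \<subseteq> {..key x}"
      by (auto simp: underS_def key_order_def)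
  qed simp
  then show "\<exists>L. linear_extension P r L \<and> omega_like P L"
    using ext countable_partial_order_linear_extension[OF cpo ext] by (auto simp: omega_like_def)
qed

lemma omega_star_like_iff_converse: "omega_star_like P r \<longleftrightarrow> omega_like P (r\<inverse>)"
  by (simp add: omega_star_like_def omega_like_def countable_partial_order_def
      underS_def aboveS_def)

lemma linear_extension_converse:
  "linear_extension P (r\<inverse>) L \<longleftrightarrow> linear_extension P r (L\<inverse>)"
  by (auto simp: linear_extension_def)

lemma linearizable_omega_star: "linearizable omega_star_like"
  unfolding linearizable_def omega_star_like_iff_converse
proof (intro allI impI)
  fix P :: "'a set" and r
  assume "omega_like P (r\<inverse>)"
  then obtain L where "linear_extension P (r\<inverse>) L" "omega_like P L"
    using linearizable_omega unfolding linearizable_def by blast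
  then show "\<exists>L. linear_extension P r L \<and> omega_like P (L\<inverse>)"
    by (intro exI[of _ "L\<inverse>"]) (simp add: linear_extension_converse)
qed

section \<open>The order type \<open>\<omega> + \<omega>\<^sup>*\<close>\<close>

lemma linearizable_omega_plus_omega_star: "linearizable omega_plus_omega_star_like"
  unfolding linearizable_def
proof (intro allI impI)
  fix P :: "'a set" and r
  assume *: "omega_plus_omega_star_like P r"
  then have cpo: "countable_partial_order P r"
    by (simp add: omega_plus_omega_star_like_def)
  then have po: "partial_order_on P r" and r: "trans r" "trans (r\<inverse>)" "r \<subseteq> P \<times> P"
    and cpo': "countable_partial_order P (r\<inverse>)"
    by (auto simp: countable_partial_order_def dest: partial_order_onD)
  define low where "low x \<longleftrightarrow> finite (under r x)" for x
  have high: "finite (under (r\<inverse>) x)" if "x \<in> P" "\<not> low x" for x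
    using * that unfolding finite_under_converse_iff_aboveS
    by (auto simp: omega_plus_omega_star_like_def low_def finite_under_iff_underS)
  have low_down: "low x" if "(x, y) \<in> r" "low y" for x y
  proof -
    have "under r x \<subseteq> under r y"
      using that(1) r(1) by (auto simp: under_def dest: transD)
    then show ?thesis
      using that(2) finite_subset unfolding low_def by blast
  qed
  \<comment> \<open>The codes of up-sets decrease along \<open>r\<close>, whence the sign; \<open>False < True\<close> puts the low part first.\<close>
  define key where "key x = (if low x then (False, int (downset_code P r x))
    else (True, - int (downset_code P (r\<inverse>) x)))" for x
  have mono: "key x \<le> key y" if "(x, y) \<in> r" for x y
  proof -
    have "(y, x) \<in> r\<inverse>" "x \<in> P" "y \<in> P"
      using that r(3) by auto
    then show ?thesis
      using that low_down[OF that] downset_code_mono[OF r(1) that, of P]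
        downset_code_mono[OF r(2), of y x P] high[of x]
      by (auto simp: key_def low_def)
  qed
  have inj: "inj_on key P"
    using downset_code_inj[OF cpo] downset_code_inj[OF cpo'] high
    by (auto intro!: inj_onI simp: key_def low_def split: if_splits)
  let ?L = "key_order P key"
  have ext: "linear_extension P r ?L"
    by (rule linear_extension_key_order[OF po inj mono])
  have "finite (underS ?L x) \<or> finite (aboveS ?L x)" if "x \<in> P" for x
  proof (cases "low x")
    case True
    have "key ` underS ?L x \<subseteq> {False} \<times> {0..int (downset_code P r x)}"
      using True by (auto simp: underS_def key_order_def key_def split: if_splits)
    moreover have "inj_on key (underS ?L x)"
      using inj by (rule inj_on_subset) (auto simp: underS_def key_order_def)
    ultimately show ?thesis
      by (meson finite.emptyI finite.insertI finite_SigmaI finite_atLeastAtMost_int inj_on_finite)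
  next
    case False
    have "key ` aboveS ?L x \<subseteq> {True} \<times> {- int (downset_code P (r\<inverse>) x)..0}"
      using False by (auto simp: aboveS_def key_order_def key_def split: if_splits)
    moreover have "inj_on key (aboveS ?L x)"
      using inj by (rule inj_on_subset) (auto simp: aboveS_def key_order_def)
    ultimately show ?thesis
      by (meson finite.emptyI finite.insertI finite_SigmaI finite_atLeastAtMost_int inj_on_finite)
  qed
  then show "\<exists>L. linear_extension P r L \<and> omega_plus_omega_star_like P L"
    using ext countable_partial_order_linear_extension[OF cpo ext]
    by (auto simp: omega_plus_omega_star_like_def)
qed

section \<open>The order type \<open>\<zeta>\<close>\<close>

definition order_convex :: "'a rel \<Rightarrow> 'a set \<Rightarrow> bool" where
  "order_convex r A \<longleftrightarrow> (\<forall>a\<in>A. \<forall>b\<in>A. \<forall>z. (a, z) \<in> r \<longrightarrow> (z, b) \<in> r \<longrightarrow> z \<in> A)"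

text \<open>The closed intervals whose end points are among the first \<open>n\<close> points of an enumeration cover
  the convex hull of these points, and finitely many finite sets have a finite union.\<close>

lemma zeta_like_convex_exhaustion:
  assumes "zeta_like P r"
  obtains C :: "nat \<Rightarrow> 'a set" where "mono C" "P \<subseteq> (\<Union>n. C n)"
    "\<forall>n. finite (C n)" "\<forall>n. order_convex r (C n)"
proof -
  have "countable P" and r: "refl_on P r" "trans r" "r \<subseteq> P \<times> P"
    using assms
    by (auto simp: zeta_like_def countable_partial_order_def dest: partial_order_onD)
  define I where "I n = {a \<in> P. to_nat_on P a < n}" for n
  have fin_I: "finite (I n)" for n
  proof (rule inj_on_finite)
    show "inj_on (to_nat_on P) (I n)"
      using inj_on_to_nat_on[OF \<open>countable P\<close>] by (rule inj_on_subset) (auto simp: I_def)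
    show "to_nat_on P ` I n \<subseteq> {..<n}"
      by (auto simp: I_def)
  qed simp
  define C where "C n = {z. \<exists>a\<in>I n. \<exists>b\<in>I n. (a, z) \<in> r \<and> (z, b) \<in> r}" for n
  have "mono C"
    by (rule monoI) (fastforce simp: C_def I_def)
  moreover have "P \<subseteq> (\<Union>n. C n)"
  proof
    fix x
    assume "x \<in> P"
    then have "x \<in> C (Suc (to_nat_on P x))"
      using r(1) by (auto simp: C_def I_def refl_on_def)
    then show "x \<in> (\<Union>n. C n)"
      by blast
  qed
  moreover have "\<forall>n. finite (C n)"
  proof (rule allI, rule finite_subset)
    fix n
    show "C n \<subseteq> (\<Union>a\<in>I n. \<Union>b\<in>I n. {a, b} \<union> (aboveS r a \<inter> underS r b))"
      by (auto simp: C_def aboveS_def underS_def)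
    show "finite (\<Union>a\<in>I n. \<Union>b\<in>I n. {a, b} \<union> (aboveS r a \<inter> underS r b))"
      using assms fin_I by (auto simp: zeta_like_def I_def)
  qed
  moreover have "\<forall>n. order_convex r (C n)"
    using transD[OF r(2)] unfolding order_convex_def C_def by blast
  ultimately show ?thesis
    by (rule that)
qed

text \<open>The grade of a point is the number of the stage at which it first appears, counted positively
  exactly when the point lies above some point of the stage before. Let \<open>(x, y) \<in> r\<close>. If \<open>y\<close> appears
  later than \<open>x\<close>, then \<open>y\<close> has positive sign because of \<open>x\<close>. If \<open>y\<close> appears earlier, then \<open>x\<close> has
  negative sign, since otherwise \<open>x\<close> would lie between two points of the stage before its own,
  contrary to convexity. If both appear together, positivity passes from \<open>x\<close> to \<open>y\<close> by
  transitivity.\<close>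

lemma convex_exhaustion_grading:
  fixes C :: "nat \<Rightarrow> 'a set"
  assumes "trans r" "r \<subseteq> P \<times> P" and C: "mono C" "P \<subseteq> (\<Union>n. C n)" "\<forall>n. finite (C n)"
    "\<forall>n. order_convex r (C n)"
  obtains h :: "'a \<Rightarrow> int" where "\<forall>(x, y)\<in>r. h x \<le> h y"
    "\<forall>k. finite {x \<in> P. h x = k}"
proof -
  define level where "level x = (LEAST n. x \<in> C n)" for x
  have in_level: "x \<in> C (level x)" if "x \<in> P" for x
    using C(2) that unfolding level_def by (meson LeastI UN_E subsetD)
  have in_earlier: "x \<in> C (n - 1)" if "x \<in> P" "level x < n" for x n
  proof -
    have "level x \<le> n - 1"
      using that(2) by simp
    then show ?thesis
      using monoD[OF C(1)] in_level[OF that(1)] by blast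
  qed
  have not_earlier: "x \<notin> C (level x - 1)" if "0 < level x" for x
    using that not_less_Least[of "level x - 1" "\<lambda>n. x \<in> C n"] unfolding level_def by simp
  \<comment> \<open>At level \<open>0\<close> truncated subtraction makes \<open>up\<close> meaningless, harmlessly: both signs give grade \<open>0\<close>.\<close>
  define up where "up x \<longleftrightarrow> (\<exists>c\<in>C (level x - 1). (c, x) \<in> r)" for x
  define h where "h x = (if up x then int (level x) else - int (level x))" for x
  have "h x \<le> h y" if xy: "(x, y) \<in> r" for x y
  proof -
    have P: "x \<in> P" "y \<in> P"
      using xy assms(2) by auto
    consider "level x < level y" | "level y < level x" | "level x = level y"
      by linarith
    then show ?thesis
    proof cases
      case 1
      then have "up y"
        using in_earlier[OF P(1) 1] xy by (auto simp: up_def)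
      then show ?thesis
        using 1 by (simp add: h_def)
    next
      case 2
      then have "\<not> up x"
        using in_earlier[OF P(2) 2] not_earlier[of x] xy C(4)
        unfolding up_def order_convex_def by (metis gr_zeroI not_less_zero)
      then show ?thesis
        using 2 by (simp add: h_def)
    next
      case 3
      then have "up x \<Longrightarrow> up y"
        using xy \<open>trans r\<close> by (auto simp: up_def dest: transD)
      then show ?thesis
        using 3 by (auto simp: h_def)
    qed
  qed
  then have "\<forall>(x, y)\<in>r. h x \<le> h y"
    by blast
  moreover have "\<forall>k. finite {x \<in> P. h x = k}"
  proof (rule allI, rule finite_subset)
    fix k
    have "level x = nat \<bar>h x\<bar>" for x
      by (simp add: h_def)
    then show "{x \<in> P. h x = k} \<subseteq> C (nat \<bar>k\<bar>)"
      using in_level by fastforce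
    show "finite (C (nat \<bar>k\<bar>))"
      using C(3) by blast
  qed
  ultimately show ?thesis
    by (rule that)
qed

lemma linearizable_zeta: "linearizable zeta_like"
  unfolding linearizable_def
proof (intro allI impI)
  fix P :: "'a set" and r
  assume zeta: "zeta_like P r"
  then have cpo: "countable_partial_order P r"
    by (simp add: zeta_like_def)
  then have po: "partial_order_on P r" and r: "refl_on P r" "trans r" "antisym r" "r \<subseteq> P \<times> P"
    by (auto simp: countable_partial_order_def dest: partial_order_onD)
  obtain C :: "nat \<Rightarrow> 'a set" where C: "mono C" "P \<subseteq> (\<Union>n. C n)"
      "\<forall>n. finite (C n)" "\<forall>n. order_convex r (C n)"
    by (rule zeta_like_convex_exhaustion[OF zeta])
  obtain h :: "'a \<Rightarrow> int" where h: "\<forall>(x, y)\<in>r. h x \<le> h y"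
    and fibre: "\<forall>k. finite {x \<in> P. h x = k}"
    by (rule convex_exhaustion_grading[OF r(2,4) C])
  \<comment> \<open>Down-sets of \<open>r\<close> may be infinite, but those of its restriction to the fibres are not.\<close>
  define s where "s = {(x, y) \<in> r. h x = h y}"
  have "trans s"
    using r(2) by (auto simp: s_def trans_def)
  then have cpo_s: "countable_partial_order P s"
    using cpo r by (auto simp: countable_partial_order_def order_on_defs s_def refl_on_def antisym_def)
  have fin_s: "finite (under s x)" for x
    by (rule finite_subset[OF _ fibre[rule_format, of "h x"]]) (use r(4) in \<open>auto simp: under_def s_def\<close>)
  define key where "key x = (h x, downset_code P s x)" for x
  have mono: "key x \<le> key y" if "(x, y) \<in> r" for x y
    using h downset_code_mono[OF \<open>trans s\<close> _ fin_s, of x y P] that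
    by (auto simp: key_def s_def)
  have inj: "inj_on key P"
    using downset_code_inj[OF cpo_s _ _ fin_s fin_s] by (auto intro!: inj_onI simp: key_def)
  let ?L = "key_order P key"
  have ext: "linear_extension P r ?L"
    by (rule linear_extension_key_order[OF po inj mono])
  have "finite (aboveS ?L x \<inter> underS ?L y)" for x y
  proof (rule finite_subset)
    show "aboveS ?L x \<inter> underS ?L y \<subseteq> (\<Union>k\<in>{h x..h y}. {z \<in> P. h z = k})"
      by (auto simp: aboveS_def underS_def key_order_def key_def)
    show "finite (\<Union>k\<in>{h x..h y}. {z \<in> P. h z = k})"
      using fibre by simp
  qed
  then show "\<exists>L. linear_extension P r L \<and> zeta_like P L"
    using ext countable_partial_order_linear_extension[OF cpo ext] by (auto simp: zeta_like_def)
qed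

theorem theorem1p3:
  shows "linearizable (omega_like :: 'a set \<Rightarrow> 'a rel \<Rightarrow> bool)
       \<and> linearizable (omega_star_like :: 'a set \<Rightarrow> 'a rel \<Rightarrow> bool)
       \<and> linearizable (omega_plus_omega_star_like :: 'a set \<Rightarrow> 'a rel \<Rightarrow> bool)
       \<and> linearizable (zeta_like :: 'a set \<Rightarrow> 'a rel \<Rightarrow> bool)"
  using linearizable_omega linearizable_omega_star linearizable_omega_plus_omega_star
    linearizable_zeta by blast

end
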